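(* There exists a constant $C>0$ such that for arbitrarily large values of $n$ there exists a set $S$ of $n$ points in general position in the plane such that, for every coloring of $S$ with two colors (red and blue), the coarseness of $S$ is at least $C n^{1/4}$.
   Context: General position means that no three points of $S$ are collinear. A coloring of a finite set $S\subset\mathbb{R}^2$ is a map $\mathcal{X}:S\to\{-1,+1\}$ (points mapped to $+1$ are red, points mapped to $-1$ are blue). For $Y\subseteq S$, the discrepancy of $Y$ is $\operatorname{disc}(Y)=\left|\sum_{y\in Y}\mathcal{X}(y)\right|$, i.e. the absolute value of the number of red points minus the number of blue points in $Y$. An island of $S$ is a subset $I\subseteq S$ such that $I=C'\cap S$ for some convex set $C'\subseteq\mathbb{R}^2$. A convex partition of $S$ is a partition $\Pi=\{S_1,\dots,S_k\}$ of $S$ into (nonempty) islands with pairwise disjoint convex hulls. Its discrepancy is $\operatorname{disc}(\Pi)=\min_{1\le i\le k}\operatorname{disc}(S_i)$. The coarseness of the colored set $S$ is $\mathcal{C}(S)=\max_{\Pi}\operatorname{disc}(\Pi)$, the maximum over all convex partitions $\Pi$ of $S$. *)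

theory Defs
  imports "HOL-Analysis.Analysis"
begin

definition general_position :: "(real^2) set \<Rightarrow> bool" where
  "general_position S \<longleftrightarrow> (\<forall>T \<subseteq> S. card T = 3 \<longrightarrow> \<not> collinear T)"

text \<open>Only the values on \<open>S\<close> matter; \<open>+1\<close> is red and \<open>-1\<close> is blue.\<close>

definition coloring :: "(real^2) set \<Rightarrow> (real^2 \<Rightarrow> int) \<Rightarrow> bool" where
  "coloring S X \<longleftrightarrow> X \<in> S \<rightarrow> {-1, 1}"

definition disc :: "(real^2 \<Rightarrow> int) \<Rightarrow> (real^2) set \<Rightarrow> int" where
  "disc X Y = \<bar>\<Sum>y\<in>Y. X y\<bar>"

definition island :: "(real^2) set \<Rightarrow> (real^2) set \<Rightarrow> bool" where
  "island S I \<longleftrightarrow> (\<exists>K. convex K \<and> I = K \<inter> S)"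

definition convex_partition :: "(real^2) set \<Rightarrow> (real^2) set set \<Rightarrow> bool" where
  "convex_partition S P \<longleftrightarrow>
     partition_on S P \<and> (\<forall>I\<in>P. island S I) \<and>
     pairwise (\<lambda>A B. convex hull A \<inter> convex hull B = {}) P"

definition partition_disc :: "(real^2 \<Rightarrow> int) \<Rightarrow> (real^2) set set \<Rightarrow> int" where
  "partition_disc X P = Min (disc X ` P)"

definition coarseness :: "(real^2) set \<Rightarrow> (real^2 \<Rightarrow> int) \<Rightarrow> int" where
  "coarseness S X = Max (partition_disc X ` {P. convex_partition S P})"

text \<open>
  For finite nonempty \<open>S\<close>, the \<^const>\<open>Min\<close> and \<^const>\<open>Max\<close> above range over finite nonempty
  sets, so they are a genuine minimum and maximum.
\<close>

lemma finite_convex_partitions: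
  assumes "finite S"
  shows "finite {P. convex_partition S P}"
proof (rule finite_subset)
  show "{P. convex_partition S P} \<subseteq> Pow (Pow S)"
    by (auto simp: convex_partition_def partition_on_def)
  show "finite (Pow (Pow S))"
    using assms by simp
qed

lemma convex_partition_single:
  assumes "S \<noteq> {}"
  shows "convex_partition S {S}"
proof -
  have "island S S"
    unfolding island_def by (rule exI[of _ UNIV]) simp
  then show ?thesis
    using assms by (simp add: convex_partition_def partition_on_def)
qed

lemma convex_partition_finite_nonempty:
  assumes "finite S" "S \<noteq> {}" "convex_partition S P"
  shows "finite P" "P \<noteq> {}"
  using assms by (auto simp: convex_partition_def partition_on_def intro: finite_UnionD)

end

theory Submission
  imports Defs
begin

text \<open>
  Cutting \<open>S\<close> by a line gives a convex partition into at most two parts, so every half-plane has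
  discrepancy at most twice the coarseness. It remains to bound half-plane discrepancy from below by
  a multiple of \<open>sqrt N\<close> for a slightly perturbed \<open>N \<times> N\<close> grid (Alexander's theorem). For lines of
  slope \<open>a\<close>, take the second difference, with a small step \<open>w\<close> in the intercept \<open>t\<close>, of the signed
  count of the points below the line. The integral of its square over \<open>t\<close> is a quadratic form in
  the colours whose kernel is the fourth difference of the absolute value. After averaging over
  \<open>a \<in> [-1, 1]\<close> with weight \<open>(1 - a\<^sup>2)\<^sup>2\<close>, the diagonal entries are of order \<open>w\<close>, while two
  integrations by parts show that the entry of two points at distance \<open>r\<close> is \<open>O(w ^ 4 / r ^ 3)\<close>. The
  latter is summable over the grid, so for small \<open>w\<close> the diagonal dominates and the integral is at
  least of order \<open>N\<^sup>2\<close>. Since the lines that matter have \<open>t\<close> in a range of length \<open>O(N)\<close>, some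
  half-plane has squared discrepancy of order \<open>N\<close>.
\<close>

subsection \<open>Fourth differences\<close>

text \<open>The unnormalised fourth central difference of step \<open>w\<close>. Its weights 1, -4,
  6, -4, 1 are the autocorrelation of the second-difference weights 1, -2, 1, which is how it arises
  from squaring.\<close>

definition diff4 :: "real \<Rightarrow> (real \<Rightarrow> real) \<Rightarrow> real \<Rightarrow> real" where
  "diff4 w h s = h (s + 2*w) - 4 * h (s + w) + 6 * h s - 4 * h (s - w) + h (s - 2*w)"

lemma has_real_derivative_diff4:
  assumes "\<And>s. (h has_real_derivative h' s) (at s)"
    and "(f has_real_derivative f') (at x within A)"
  shows "((\<lambda>x. diff4 w h (f x)) has_real_derivative diff4 w h' (f x) * f') (at x within A)"
proof -
  have "((\<lambda>x. h (f x + c)) has_real_derivative h' (f x + c) * f') (at x within A)" for c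
    by (rule DERIV_chain2[OF assms(1)]) (auto intro!: derivative_eq_intros assms(2))
  note D = this this[of 0, simplified] this[of "- _", simplified]
  show ?thesis
    unfolding diff4_def
    by (rule derivative_eq_intros D refl)+ (simp add: algebra_simps)
qed

lemma continuous_on_diff4 [continuous_intros]:
  assumes "continuous_on UNIV h" "continuous_on A f"
  shows "continuous_on A (\<lambda>x. diff4 w h (f x))"
  unfolding diff4_def
  by (intro continuous_intros continuous_on_compose2[OF assms(1)] assms(2)) auto

text \<open>\<open>s * \<bar>s\<bar>\<close> and \<open>\<bar>s\<bar> ^ 3\<close> are, up to the
  factors 2 and 3, successive antiderivatives of the absolute value. Both are differentiable at 0 as
  well, so integration by parts needs no splitting at the kink.\<close>

lemma has_real_derivative_mult_abs:
  "((\<lambda>s. s * \<bar>s\<bar>) has_real_derivative 2 * \<bar>s\<bar>) (at s)" for s :: real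
proof (cases "s = 0")
  case True
  have "((\<lambda>h::real. \<bar>h\<bar>) \<longlongrightarrow> 0) (at 0)"
    by (rule tendsto_eq_intros refl)+ simp
  then have "((\<lambda>h::real. (h * \<bar>h\<bar>) / h) \<longlongrightarrow> 0) (at 0)"
    by (rule Lim_transform_eventually) (auto simp: eventually_at intro!: exI[of _ 1])
  then show ?thesis
    using True by (simp add: DERIV_def)
next
  case False
  then consider "s > 0" | "s < 0" by linarith
  then show ?thesis
  proof cases
    case 1
    have "((\<lambda>s. s * s) has_real_derivative 2 * \<bar>s\<bar>) (at s)"
      using 1 by (auto intro!: derivative_eq_intros)
    then show ?thesis
      by (rule has_field_derivative_transform_within_open[where S = "{0<..}"]) (use 1 in auto)
  next
    case 2
    have "((\<lambda>s. - (s * s)) has_real_derivative 2 * \<bar>s\<bar>) (at s)"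
      using 2 by (auto intro!: derivative_eq_intros)
    then show ?thesis
      by (rule has_field_derivative_transform_within_open[where S = "{..<0}"]) (use 2 in auto)
  qed
qed

lemma has_real_derivative_abs_cube:
  "((\<lambda>s. \<bar>s\<bar> ^ 3) has_real_derivative 3 * (s * \<bar>s\<bar>)) (at s)" for s :: real
proof -
  have "(\<lambda>s::real. \<bar>s\<bar> ^ 3) = (\<lambda>s. s * (s * \<bar>s\<bar>))"
    by (auto simp: fun_eq_iff power3_eq_cube abs_if)
  then show ?thesis
    using DERIV_mult[OF DERIV_ident has_real_derivative_mult_abs, of s] by (simp add: mult_ac)
qed

text \<open>All five nodes lie weakly on one side of 0, where the absolute value is linear, and
  fourth differences annihilate polynomials of degree at most 3. The same reason serves for
  \<open>\<bar>s\<bar> ^ 3\<close> below.\<close>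

lemma diff4_abs_eq_0: "w > 0 \<Longrightarrow> 2 * w \<le> \<bar>s\<bar> \<Longrightarrow> diff4 w abs s = 0"
  unfolding diff4_def by (auto simp: abs_if split: if_splits)

lemma diff4_abs_0: "w > 0 \<Longrightarrow> diff4 w abs 0 = - 4 * w"
  unfolding diff4_def by (auto simp: abs_if split: if_splits)

lemma diff4_uminus:
  assumes "\<And>s. h (- s) = h s"
  shows "diff4 w h (- s) = diff4 w h s"
proof -
  have "h (2 * w - s) = h (s - 2 * w)" "h (w - s) = h (s - w)" "h (- s - w) = h (s + w)"
    "h (- s - 2 * w) = h (s + 2 * w)"
    using assms[of "s - 2 * w"] assms[of "s - w"] assms[of "s + w"] assms[of "s + 2 * w"]
    by (simp_all add: algebra_simps)
  then show ?thesis
    unfolding diff4_def by (simp add: assms)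
qed

lemma diff4_abs_cube_eq_0:
  assumes "w > 0" "2 * w \<le> \<bar>s\<bar>"
  shows "diff4 w (\<lambda>s. \<bar>s\<bar> ^ 3) s = 0"
proof -
  have *: "diff4 w (\<lambda>s. \<bar>s\<bar> ^ 3) s = 0" if "2 * w \<le> s" for s
  proof -
    have "diff4 w (\<lambda>s. \<bar>s\<bar> ^ 3) s =
      (s + 2*w)^3 - 4 * (s + w)^3 + 6 * s^3 - 4 * (s - w)^3 + (s - 2*w)^3"
      using that assms(1) unfolding diff4_def by simp
    also have "\<dots> = 0" by algebra
    finally show ?thesis .
  qed
  show ?thesis
    using *[of s] *[of "- s"] diff4_uminus[of "\<lambda>s. \<bar>s\<bar> ^ 3" w s] assms(2)
    by (cases "s \<ge> 0") auto
qed

lemma diff4_abs_cube_bound: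
  assumes "w > 0"
  shows "\<bar>diff4 w (\<lambda>s. \<bar>s\<bar> ^ 3) s\<bar> \<le> (if \<bar>s\<bar> \<le> 2 * w then 392 * w ^ 3 else 0)"
proof (cases "\<bar>s\<bar> \<le> 2 * w")
  case True
  have b: "0 \<le> \<bar>s + c * w\<bar> ^ 3 \<and> \<bar>s + c * w\<bar> ^ 3 \<le> (2 + \<bar>c\<bar>) ^ 3 * w ^ 3" for c
  proof -
    have "\<bar>s + c * w\<bar> \<le> (2 + \<bar>c\<bar>) * w"
      using True assms abs_triangle_ineq[of s "c * w"] by (simp add: abs_mult algebra_simps)
    then have "\<bar>s + c * w\<bar> ^ 3 \<le> ((2 + \<bar>c\<bar>) * w) ^ 3"
      by (intro power_mono) auto
    then show ?thesis
      by (simp add: power_mult_distrib)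
  qed
  \<comment> \<open>The triangle inequality on the five nodes: 64 + 4 * 27 + 6 * 8 + 4 * 27 + 64 =
    392.\<close>
  have "\<bar>p - 4 * q + 6 * r - 4 * t + v\<bar> \<le> 392 * W"
    if "0 \<le> p \<and> p \<le> 64 * W" "0 \<le> q \<and> q \<le> 27 * W" "0 \<le> r \<and> r \<le> 8 * W"
      "0 \<le> t \<and> t \<le> 27 * W" "0 \<le> v \<and> v \<le> 64 * W" for p q r t v W :: real
    using that by linarith
  note lin = this
  have "\<bar>\<bar>s + 2 * w\<bar> ^ 3 - 4 * \<bar>s + w\<bar> ^ 3 + 6 * \<bar>s\<bar> ^ 3 - 4 * \<bar>s - w\<bar> ^ 3 + \<bar>s - 2 * w\<bar> ^ 3\<bar>
      \<le> 392 * w ^ 3"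
    by (rule lin) (use b[of 2] b[of 1] b[of 0] b[of "-1"] b[of "-2"] in simp_all)
  then show ?thesis
    using True unfolding diff4_def by (simp del: abs_abs)
next
  case False
  then show ?thesis
    using diff4_abs_cube_eq_0[of w s] assms by auto
qed

section \<open>Averaging the kernel over slopes\<close>

text \<open>Each integration by parts in \<open>a\<close> gains a factor \<open>1 / dx\<close>. The
  weight has double zeros at -1 and 1, so no boundary terms appear;
  \<open>12 * a\<^sup>2 - 4\<close> is its second derivative, and 6 = 2 * 3 comes from the two
  antiderivatives.\<close>

lemma weight_by_parts:
  fixes dx dy w :: real
  assumes "dx \<noteq> 0"
  shows "integral {-1..1} (\<lambda>a. (1 - a\<^sup>2)\<^sup>2 * diff4 w abs (dy - a * dx)) =
    integral {-1..1} (\<lambda>a. (12 * a\<^sup>2 - 4) * diff4 w (\<lambda>s. \<bar>s\<bar> ^ 3) (dy - a * dx)) / (6 * dx\<^sup>2)"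
    (is "integral _ ?f = integral _ ?g / _")
proof -
  \<comment> \<open>Naming the reciprocal turns the derivative identity below into a polynomial one
    modulo \<open>2 * k * dx = 1\<close>.\<close>
  define k where "k = 1 / (2 * dx)"
  have k: "2 * k * dx = 1" "1 / (6 * dx\<^sup>2) = 2 / 3 * k\<^sup>2"
    using assms by (simp_all add: k_def power2_eq_square)
  let ?W = "\<lambda>a. - ((1 - a\<^sup>2)\<^sup>2 * diff4 w (\<lambda>s. s * \<bar>s\<bar>) (dy - a * dx) * k)
    - (4 * a ^ 3 - 4 * a) * diff4 w (\<lambda>s. \<bar>s\<bar> ^ 3) (dy - a * dx) * (2 / 3 * k\<^sup>2)"
  have scale: "diff4 w (\<lambda>s. c * h s) s = c * diff4 w h s" for c h s
    unfolding diff4_def by (simp add: algebra_simps)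
  have "(?W has_real_derivative ?f a - ?g a * (2 / 3 * k\<^sup>2)) (at a within {-1..1})" for a
  proof -
    have lin: "((\<lambda>a. dy - a * dx) has_real_derivative - dx) (at a within {-1..1})"
      by (auto intro!: derivative_eq_intros)
    note D = has_real_derivative_diff4[OF has_real_derivative_mult_abs lin, of w, unfolded scale]
      has_real_derivative_diff4[OF has_real_derivative_abs_cube lin, of w, unfolded scale]
    have P: "((\<lambda>a. (1 - a\<^sup>2)\<^sup>2) has_real_derivative 4 * a ^ 3 - 4 * a) (at a within {-1..1})"
      by (auto intro!: derivative_eq_intros simp: power2_eq_square power3_eq_cube algebra_simps)
    have Q: "((\<lambda>a. 4 * a ^ 3 - 4 * a) has_real_derivative 12 * a\<^sup>2 - 4) (at a within {-1..1})"
      by (auto intro!: derivative_eq_intros)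
    have combine: "((\<lambda>a. - (p a * g a * k) - q a * h a * m) has_real_derivative
        - ((p' * g a + g' * p a) * k) - (q' * h a + h' * q a) * m) (at a within {-1..1})"
      if "(p has_real_derivative p') (at a within {-1..1})" "(q has_real_derivative q') (at a within {-1..1})"
        "(g has_real_derivative g') (at a within {-1..1})" "(h has_real_derivative h') (at a within {-1..1})"
      for p q g h p' q' g' h' m
      by (rule derivative_eq_intros that refl)+ simp
    have "- (((4 * a ^ 3 - 4 * a) * q + (2 * p * - dx) * (1 - a\<^sup>2)\<^sup>2) * k)
        - ((12 * a\<^sup>2 - 4) * r + (3 * q * - dx) * (4 * a ^ 3 - 4 * a)) * (2 / 3 * k\<^sup>2)
      = (1 - a\<^sup>2)\<^sup>2 * p - (12 * a\<^sup>2 - 4) * r * (2 / 3 * k\<^sup>2)" for p q r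
      using k(1) by algebra
    then show ?thesis
      by (rule DERIV_cong[OF combine[OF P Q D]])
  qed
  then have "((\<lambda>a. ?f a - ?g a * (2 / 3 * k\<^sup>2)) has_integral (?W 1 - ?W (-1))) {-1..1}"
    by (intro fundamental_theorem_of_calculus)
      (auto simp: has_real_derivative_iff_has_vector_derivative)
  \<comment> \<open>\<open>?W\<close> is 0 at both endpoints, since the weight and its derivative
    \<open>4 * a ^ 3 - 4 * a\<close> vanish there.\<close>
  then have "integral {-1..1} (\<lambda>a. ?f a - ?g a * (2 / 3 * k\<^sup>2)) = 0"
    by (simp add: integral_unique)
  moreover have "integral {-1..1} (\<lambda>a. ?f a - ?g a * (2 / 3 * k\<^sup>2)) =
    integral {-1..1} ?f - integral {-1..1} (\<lambda>a. ?g a * (2 / 3 * k\<^sup>2))"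
    by (intro Henstock_Kurzweil_Integration.integral_diff integrable_continuous_interval continuous_intros) auto
  ultimately have "integral {-1..1} ?f = integral {-1..1} ?g * (1 / (6 * dx\<^sup>2))"
    unfolding k(2) by (simp only: integral_mult_left right_minus_eq)
  then show ?thesis by simp
qed

text \<open>The slopes with \<open>\<bar>dy - a * dx\<bar> \<le> r\<close> form an interval of
  length \<open>2 * r / \<bar>dx\<bar>\<close> about \<open>dy / dx\<close>. It may stick out of
  [-1, 1], so both integrands are extended by 0 to the whole line.\<close>

lemma integral_window_bound:
  fixes f :: "real \<Rightarrow> real"
  assumes dx: "dx \<noteq> 0" and "0 \<le> r" "0 \<le> M"
    and cont: "continuous_on {-1..1} f"
    and f: "\<And>a. a \<in> {-1..1} \<Longrightarrow> \<bar>f a\<bar> \<le> (if \<bar>dy - a * dx\<bar> \<le> r then M else 0)"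
  shows "\<bar>integral {-1..1} f\<bar> \<le> M * (2 * r / \<bar>dx\<bar>)"
proof -
  define c where "c = dy / dx"
  define e where "e = r / \<bar>dx\<bar>"
  have "e \<ge> 0" unfolding e_def using \<open>0 \<le> r\<close> by simp
  have win: "\<bar>dy - a * dx\<bar> \<le> r \<longleftrightarrow> a \<in> {c - e..c + e}" for a
  proof -
    have "\<bar>dy - a * dx\<bar> = \<bar>c - a\<bar> * \<bar>dx\<bar>"
      unfolding c_def abs_mult[symmetric] using dx by (simp add: left_diff_distrib)
    then have "\<bar>dy - a * dx\<bar> \<le> r \<longleftrightarrow> \<bar>c - a\<bar> \<le> e"
      unfolding e_def using dx by (simp add: pos_le_divide_eq)
    then show ?thesis by auto
  qed
  have "((\<lambda>a. M) has_integral M * (2 * e)) {c - e..c + e}"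
    using has_integral_const_real[of M "c - e" "c + e"] \<open>e \<ge> 0\<close> by (simp add: mult.commute)
  then have C: "((\<lambda>a. if a \<in> {c - e..c + e} then M else 0) has_integral M * (2 * e)) UNIV"
    by (simp only: has_integral_restrict_UNIV)
  have "(f has_integral integral {-1..1} f) {-1..1}"
    using cont by (intro integrable_integral integrable_continuous_interval)
  then have F: "((\<lambda>a. if a \<in> {-1..1} then f a else 0) has_integral integral {-1..1} f) UNIV"
    by (simp only: has_integral_restrict_UNIV)
  have le: "\<bar>if a \<in> {-1..1} then f a else 0\<bar> \<le> (if a \<in> {c - e..c + e} then M else 0)" for a
    using f[of a] win[of a] \<open>0 \<le> M\<close> by auto
  have "integral {-1..1} f \<le> M * (2 * e)"
    by (rule has_integral_le[OF F C]) (rule abs_le_D1[OF le])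
  moreover have "- integral {-1..1} f \<le> M * (2 * e)"
    by (rule has_integral_le[OF has_integral_neg[OF F] C]) (rule abs_le_D2[OF le])
  ultimately have "\<bar>integral {-1..1} f\<bar> \<le> M * (2 * e)"
    by simp
  then show ?thesis unfolding e_def by simp
qed

text \<open>After the integrations by parts the integrand is of size \<open>w ^ 3\<close> on a
  window of length \<open>4 * w / \<bar>dx\<bar>\<close>, and the prefactor supplies
  \<open>1 / dx\<^sup>2\<close>. A direct estimate would give only order
  \<open>w\<^sup>2 / \<bar>dx\<bar>\<close>, which is not summable over the grid. The constant
  rounds up 8 * 392 * 4 / 6.\<close>

lemma weight_kernel_bound:
  fixes dx dy w :: real
  assumes "dx \<noteq> 0" "w > 0"
  shows "\<bar>integral {-1..1} (\<lambda>a. (1 - a\<^sup>2)\<^sup>2 * diff4 w abs (dy - a * dx))\<bar> \<le> 2112 * w ^ 4 / \<bar>dx\<bar> ^ 3"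
proof -
  let ?g = "\<lambda>a. (12 * a\<^sup>2 - 4) * diff4 w (\<lambda>s. \<bar>s\<bar> ^ 3) (dy - a * dx)"
  have "\<bar>integral {-1..1} ?g\<bar> \<le> (8 * (392 * w ^ 3)) * (2 * (2 * w) / \<bar>dx\<bar>)"
  proof (rule integral_window_bound)
    fix a :: real
    assume a: "a \<in> {-1..1}"
    then have "a\<^sup>2 \<le> 1" by (auto simp: abs_square_le_1)
    then have "\<bar>12 * a\<^sup>2 - 4\<bar> \<le> 8"
      using zero_le_power2[of a] by linarith
    then have "\<bar>?g a\<bar> \<le> 8 * (if \<bar>dy - a * dx\<bar> \<le> 2 * w then 392 * w ^ 3 else 0)"
      unfolding abs_mult using diff4_abs_cube_bound[OF assms(2), of "dy - a * dx"]
      by (intro mult_mono) auto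
    then show "\<bar>?g a\<bar> \<le> (if \<bar>dy - a * dx\<bar> \<le> 2 * w then 8 * (392 * w ^ 3) else 0)"
      by auto
  qed (use assms in \<open>auto intro!: continuous_intros\<close>)
  also have "\<dots> = 12544 * w ^ 4 / \<bar>dx\<bar>"
    by (simp add: eval_nat_numeral)
  finally have "\<bar>integral {-1..1} ?g\<bar> / (6 * dx\<^sup>2) \<le> 12544 * w ^ 4 / \<bar>dx\<bar> / (6 * dx\<^sup>2)"
    by (intro divide_right_mono) auto
  also have "\<dots> = 12544 / 6 * w ^ 4 / (\<bar>dx\<bar> * \<bar>dx\<bar>\<^sup>2)"
    by simp
  also have "\<bar>dx\<bar> * \<bar>dx\<bar>\<^sup>2 = \<bar>dx\<bar> ^ 3"
    by (simp only: power2_eq_square power3_eq_cube mult.assoc)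
  also have "12544 / 6 * w ^ 4 / \<bar>dx\<bar> ^ 3 \<le> 2112 * w ^ 4 / \<bar>dx\<bar> ^ 3"
    using assms(2) by (intro divide_right_mono mult_right_mono) auto
  finally show ?thesis
    using weight_by_parts[OF assms(1), of w dy] by (simp add: abs_divide)
qed

subsection \<open>The energy of a signed point set on a line\<close>

text \<open>The product of two steps integrates to \<open>R - max (x i) (x j)\<close>, and the
  maximum is half of \<open>x i + x j + \<bar>x i - x j\<bar>\<close>. Terms depending on only one
  of the two positions vanish because the total weight is 0.\<close>

lemma step_energy:
  fixes x c :: "'a \<Rightarrow> real"
  assumes "finite I" "(\<Sum>i\<in>I. c i) = 0" "\<And>i. i \<in> I \<Longrightarrow> \<bar>x i\<bar> \<le> R"
  shows "((\<lambda>t. (\<Sum>i\<in>I. c i * of_bool (x i < t))\<^sup>2) has_integral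
    - (\<Sum>i\<in>I. \<Sum>j\<in>I. c i * c j * \<bar>x i - x j\<bar>) / 2) {-R..R}"
proof -
  have step: "((\<lambda>t. of_bool (x i < t) * of_bool (x j < t)) has_integral R - max (x i) (x j)) {-R..R}"
    if "i \<in> I" "j \<in> I" for i j
  proof -
    let ?m = "max (x i) (x j)"
    have m: "- R \<le> ?m" "?m \<le> R"
      using assms(3)[OF that(1)] assms(3)[OF that(2)] by linarith+
    have one: "((\<lambda>t. 1) has_integral R - ?m) {?m..R}"
      using has_integral_const_real[of "1::real" ?m R] m by simp
    have "((\<lambda>t. of_bool (x i < t) * of_bool (x j < t)) has_integral R - ?m) {?m..R}"
      by (rule has_integral_spike_finite[OF _ _ one, where S = "{?m}"]) auto
    moreover have "((\<lambda>t. of_bool (x i < t) * of_bool (x j < t)) has_integral (0::real)) {-R..?m}"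
      by (rule has_integral_is_0) auto
    ultimately show ?thesis
      using has_integral_combine[OF m] by fastforce
  qed
  have eq: "(\<Sum>i\<in>I. c i * of_bool (x i < t))\<^sup>2 =
    (\<Sum>i\<in>I. \<Sum>j\<in>I. c i * c j * (of_bool (x i < t) * of_bool (x j < t)))" for t
    unfolding power2_eq_square sum_product by (intro sum.cong refl) (simp add: mult_ac)
  have "((\<lambda>t. (\<Sum>i\<in>I. c i * of_bool (x i < t))\<^sup>2) has_integral
    (\<Sum>i\<in>I. \<Sum>j\<in>I. c i * c j * (R - max (x i) (x j)))) {-R..R}"
    unfolding eq by (intro has_integral_sum has_integral_mult_right step assms(1))
  also have "(\<Sum>i\<in>I. \<Sum>j\<in>I. c i * c j * (R - max (x i) (x j))) =
    (\<Sum>i\<in>I. \<Sum>j\<in>I. (R * c i - c i * x i / 2) * c j - c i * (c j * x j / 2) - c i * c j * \<bar>x i - x j\<bar> / 2)"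
    by (intro sum.cong refl) (auto simp: max_def abs_if field_simps)
  also have "\<dots> = - (\<Sum>i\<in>I. \<Sum>j\<in>I. c i * c j * \<bar>x i - x j\<bar>) / 2"
    by (simp only: sum_subtractf sum_product[symmetric] assms(2) sum_divide_distrib[symmetric])
  finally show ?thesis .
qed

text \<open>
  Applied with \<open>u\<close> the intercepts of the points. Each point is replaced by three, shifted by \<open>-w\<close>,
  \<open>0\<close>, \<open>w\<close> and weighted \<open>1\<close>, \<open>-2\<close>, \<open>1\<close>, so that the total weight vanishes.
\<close>
lemma energy_bound:
  fixes u c :: "'a \<Rightarrow> real"
  assumes I: "finite I" and "0 \<le> w" and R: "\<And>i. i \<in> I \<Longrightarrow> \<bar>u i\<bar> + w \<le> R"
    and D: "\<And>t. \<bar>\<Sum>i\<in>I. c i * of_bool (u i < t)\<bar> \<le> D" and "R \<ge> 0"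
  shows "- (\<Sum>i\<in>I. \<Sum>j\<in>I. c i * c j * diff4 w abs (u i - u j)) \<le> 64 * R * D\<^sup>2"
proof -
  define v :: "'a \<times> int \<Rightarrow> real" where "v = (\<lambda>(i, k). u i + k * w)"
  define b :: "'a \<times> int \<Rightarrow> real" where "b = (\<lambda>(i, k). if k = 0 then - 2 * c i else c i)"
  let ?J = "I \<times> {-1, 0, 1::int}"
  let ?F = "\<lambda>t. \<Sum>i\<in>I. c i * of_bool (u i < t)"
  have J: "(\<Sum>p\<in>?J. f p) = (\<Sum>i\<in>I. f (i, -1) + f (i, 0) + f (i, 1))" for f :: "_ \<Rightarrow> real"
    unfolding sum.cartesian_product' by (simp add: add.assoc)
  have "((\<lambda>t. (\<Sum>p\<in>?J. b p * of_bool (v p < t))\<^sup>2) has_integral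
      - (\<Sum>p\<in>?J. \<Sum>q\<in>?J. b p * b q * \<bar>v p - v q\<bar>) / 2) {-R..R}"
  proof (rule step_energy)
    show "(\<Sum>p\<in>?J. b p) = 0" unfolding J by (simp add: b_def)
    show "\<bar>v p\<bar> \<le> R" if "p \<in> ?J" for p
      using that R[of "fst p"] \<open>0 \<le> w\<close> by (auto simp: v_def)
  qed (use I in simp)
  moreover have "((\<lambda>t. 16 * D\<^sup>2) has_integral 32 * R * D\<^sup>2) {-R..R}"
    using has_integral_const_real[of "16 * D\<^sup>2" "- R" R] \<open>R \<ge> 0\<close> by (simp add: mult_ac)
  \<comment> \<open>The tripled sum is the second difference of \<open>?F\<close> at
    \<open>t\<close>, hence at most (1 + 2 + 1) \<open>D\<close> in absolute value.\<close>
  moreover have "(\<Sum>p\<in>?J. b p * of_bool (v p < t))\<^sup>2 \<le> 16 * D\<^sup>2" for t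
  proof -
    have "(\<Sum>p\<in>?J. b p * of_bool (v p < t)) = ?F (t + w) - 2 * ?F t + ?F (t - w)"
      unfolding J by (simp add: b_def v_def sum_distrib_left sum.distrib[symmetric]
          sum_subtractf[symmetric] algebra_simps)
    then have "\<bar>\<Sum>p\<in>?J. b p * of_bool (v p < t)\<bar> \<le> 4 * D"
      using D[of "t + w"] D[of t] D[of "t - w"] by linarith
    then have "\<bar>\<Sum>p\<in>?J. b p * of_bool (v p < t)\<bar>\<^sup>2 \<le> (4 * D)\<^sup>2"
      by (intro power_mono) auto
    then show ?thesis by (simp add: power_mult_distrib)
  qed
  ultimately have "- (\<Sum>p\<in>?J. \<Sum>q\<in>?J. b p * b q * \<bar>v p - v q\<bar>) / 2 \<le> 32 * R * D\<^sup>2"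
    by (rule has_integral_le)
  \<comment> \<open>Grouping the nine pairs of shifts by their difference: 0 has weight 1 + 4 + 1 =
    6, each of \<open>w\<close> and \<open>-w\<close> has -2 - 2 = -4, each of \<open>2 * w\<close>
    and \<open>- 2 * w\<close> has 1.\<close>
  moreover have "(\<Sum>p\<in>?J. \<Sum>q\<in>?J. b p * b q * \<bar>v p - v q\<bar>) =
    (\<Sum>i\<in>I. \<Sum>j\<in>I. c i * c j * diff4 w abs (u i - u j))"
    unfolding J sum.distrib[symmetric]
  proof (intro sum.cong refl, goal_cases)
    case (1 i j)
    define d where "d = u i - u j"
    have v: "v (i, k) - v (j, l) = d + (k - l) * w" for k l
      by (simp add: v_def d_def algebra_simps)
    have b: "b (i, 0) = - 2 * c i" "b (i, 1) = c i" "b (i, -1) = c i" for i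
      by (simp_all add: b_def)
    have d: "d + (of_int (- 1) - of_int (- 1)) * w = d" "d + (of_int (- 1) - of_int 0) * w = d - w"
      "d + (of_int (- 1) - of_int 1) * w = d - 2 * w" "d + (of_int 0 - of_int (- 1)) * w = d + w"
      "d + (of_int 0 - of_int 0) * w = d" "d + (of_int 0 - of_int 1) * w = d - w"
      "d + (of_int 1 - of_int (- 1)) * w = d + 2 * w" "d + (of_int 1 - of_int 0) * w = d + w"
      "d + (of_int 1 - of_int 1) * w = d"
      by simp_all
    show ?case
      unfolding v b d diff4_def d_def[symmetric] by (simp add: algebra_simps)
  qed
  ultimately show ?thesis by simp
qed

subsection \<open>Half-plane discrepancy of perturbed grids\<close>

lemma sum_inverse_squares_le: "(\<Sum>k<n. 1 / (real (Suc k))\<^sup>2) \<le> 2"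
proof -
  \<comment> \<open>Strengthened so that the induction telescopes. At \<open>n = 0\<close> the bound
    reads 2, as \<open>1 / 0 = 0\<close>, so the step from 0 is treated separately.\<close>
  have "(\<Sum>k<n. 1 / (real (Suc k))\<^sup>2) \<le> 2 - 1 / real n"
  proof (induction n)
    case (Suc n)
    show ?case
    proof (cases "n = 0")
      case False
      have "1 / (real (Suc n))\<^sup>2 \<le> 1 / (real n * real (Suc n))"
        using False by (intro divide_left_mono) (auto simp: power2_eq_square)
      also have "\<dots> = 1 / real n - 1 / real (Suc n)"
        using False by (simp add: field_simps)
      finally show ?thesis using Suc by simp
    qed simp
  qed simp
  also have "\<dots> \<le> 2" by simp
  finally show ?thesis .
qed

lemma sum_inverse_square_distances_le:
  assumes "i < N"
  shows "(\<Sum>k\<in>{..<N} - {i}. 1 / (real_of_int (int k - int i))\<^sup>2) \<le> 4"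
proof -
  let ?f = "\<lambda>k. 1 / (real_of_int (int k - int i))\<^sup>2"
  have split: "{..<N} - {i} = {..<i} \<union> {i<..<N}"
    using assms by auto
  have "sum ?f ({..<N} - {i}) = sum ?f {..<i} + sum ?f {i<..<N}"
    unfolding split by (rule sum.union_disjoint) auto
  also have "sum ?f {..<i} = (\<Sum>k<i. 1 / (real (Suc k))\<^sup>2)"
  proof (rule sum.reindex_bij_witness[where i = "\<lambda>k. i - Suc k" and j = "\<lambda>k. i - Suc k"])
    fix k
    assume "k \<in> {..<i}"
    then have "real (Suc (i - Suc k)) = - real_of_int (int k - int i)"
      by (simp add: of_nat_diff)
    then show "1 / (real (Suc (i - Suc k)))\<^sup>2 = ?f k"
      by (simp only: power2_minus)
  qed auto
  also have "sum ?f {i<..<N} = (\<Sum>k<N - Suc i. 1 / (real (Suc k))\<^sup>2)"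
    by (rule sum.reindex_bij_witness[where i = "\<lambda>k. Suc i + k" and j = "\<lambda>k. k - Suc i"])
      (auto simp: of_nat_diff)
  finally show ?thesis
    using sum_inverse_squares_le[of i] sum_inverse_squares_le[of "N - Suc i"] by linarith
qed

text \<open>A column at horizontal distance \<open>m \<ge> 1\<close> meets the cone in at most
  \<open>2 * m + 3 \<le> 5 * m\<close> points and so contributes at most
  \<open>5 / m\<^sup>2\<close>; the inverse squares over all other columns sum to at most 4.\<close>

lemma cone_sum_le:
  assumes "i < N"
  shows "(\<Sum>(k, l)\<in>{..<N} \<times> {..<N}. if k \<noteq> i \<and> \<bar>int l - int j\<bar> \<le> \<bar>int k - int i\<bar> + 1
    then 1 / real_of_int \<bar>int k - int i\<bar> ^ 3 else 0) \<le> 20"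
proof -
  have col: "(\<Sum>l<N. if k \<noteq> i \<and> \<bar>int l - int j\<bar> \<le> \<bar>int k - int i\<bar> + 1
      then 1 / real_of_int \<bar>int k - int i\<bar> ^ 3 else 0)
    \<le> (if k = i then 0 else 5 * (1 / (real_of_int (int k - int i))\<^sup>2))" for k
  proof (cases "k = i")
    case False
    define m where "m = \<bar>int k - int i\<bar>"
    have m: "m \<ge> 1" using False unfolding m_def by linarith
    have "(\<Sum>l<N. if k \<noteq> i \<and> \<bar>int l - int j\<bar> \<le> m + 1 then 1 / real_of_int m ^ 3 else 0)
      = real (card {l\<in>{..<N}. \<bar>int l - int j\<bar> \<le> m + 1}) * (1 / real_of_int m ^ 3)"
      using False by (simp add: sum.If_cases Int_def)
    also have "card {l\<in>{..<N}. \<bar>int l - int j\<bar> \<le> m + 1} \<le> card {int j - m - 1..int j + m + 1}"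
      by (rule card_inj_on_le[where f = int]) auto
    then have "real (card {l\<in>{..<N}. \<bar>int l - int j\<bar> \<le> m + 1}) * (1 / real_of_int m ^ 3)
      \<le> (5 * real_of_int m) * (1 / real_of_int m ^ 3)"
      using m by (intro mult_right_mono) auto
    also have "\<dots> = 5 * (1 / (real_of_int m)\<^sup>2)"
      using m by (simp add: power2_eq_square power3_eq_cube)
    finally show ?thesis
      using False unfolding m_def by simp
  qed simp
  have "(\<Sum>(k, l)\<in>{..<N} \<times> {..<N}. if k \<noteq> i \<and> \<bar>int l - int j\<bar> \<le> \<bar>int k - int i\<bar> + 1
      then 1 / real_of_int \<bar>int k - int i\<bar> ^ 3 else 0)
    \<le> (\<Sum>k<N. if k = i then 0 else 5 * (1 / (real_of_int (int k - int i))\<^sup>2))"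
    unfolding sum.cartesian_product[symmetric] by (intro sum_mono col)
  also have "\<dots> = (\<Sum>k\<in>{..<N} - {i}. 5 * (1 / (real_of_int (int k - int i))\<^sup>2))"
    by (rule sum.mono_neutral_cong_right) auto
  also have "\<dots> \<le> 20"
    using sum_inverse_square_distances_le[OF assms] by (simp only: sum_distrib_left[symmetric])
  finally show ?thesis .
qed

section \<open>Diagonal dominance on a perturbed grid\<close>

lemma integral_weight: "((\<lambda>a::real. (1 - a\<^sup>2)\<^sup>2) has_integral 16 / 15) {-1..1}"
proof -
  let ?W = "\<lambda>a::real. a - 2 / 3 * a ^ 3 + a ^ 5 / 5"
  have "(?W has_real_derivative (1 - a\<^sup>2)\<^sup>2) (at a within {-1..1})" for a
    by (auto intro!: derivative_eq_intros simp: power2_diff power_mult[symmetric])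
  then have "((\<lambda>a::real. (1 - a\<^sup>2)\<^sup>2) has_integral ?W 1 - ?W (-1)) {-1..1}"
    by (intro fundamental_theorem_of_calculus)
      (auto simp: has_real_derivative_iff_has_vector_derivative)
  then show ?thesis by simp
qed

text \<open>
  The kernel vanishes for points of the same column and for pairs too steep to be met by a line of
  slope in \<open>[-1, 1]\<close>.
\<close>
lemma perturbed_grid_kernel_bound:
  fixes x y :: "nat \<times> nat \<Rightarrow> real"
  assumes x: "\<bar>x (i, j) - i\<bar> \<le> 1/8" "\<bar>x (k, l) - k\<bar> \<le> 1/8"
    and y: "\<bar>y (i, j) - j\<bar> \<le> 1/8" "\<bar>y (k, l) - l\<bar> \<le> 1/8"
    and ne: "(i, j) \<noteq> (k, l)"
  shows "\<bar>integral {-1..1} (\<lambda>a. (1 - a\<^sup>2)\<^sup>2 *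
      diff4 (1/100) abs ((y (i, j) - y (k, l)) - a * (x (i, j) - x (k, l))))\<bar>
    \<le> (if k \<noteq> i \<and> \<bar>int l - int j\<bar> \<le> \<bar>int k - int i\<bar> + 1
        then 1 / real_of_int \<bar>int k - int i\<bar> ^ 3 else 0) / 19000"
proof -
  define dx where "dx = x (i, j) - x (k, l)"
  define dy where "dy = y (i, j) - y (k, l)"
  define m where "m = real_of_int \<bar>int k - int i\<bar>"
  have m: "m = \<bar>real k - real i\<bar>"
    unfolding m_def by simp
  have dx: "\<bar>dx\<bar> \<le> m + 1/4" "\<bar>dx\<bar> \<ge> m - 1/4"
    using x unfolding dx_def m by linarith+
  have "\<bar>dy\<bar> \<ge> \<bar>real l - real j\<bar> - 1/4"
    using y unfolding dy_def by linarith
  then have dy: "\<bar>dy\<bar> \<ge> real_of_int \<bar>int l - int j\<bar> - 1/4"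
    by simp
  \<comment> \<open>For \<open>\<bar>a\<bar> \<le> 1\<close> the argument has absolute value at
    least \<open>\<bar>dy\<bar> - \<bar>dx\<bar>\<close>, and 1/50 is twice the step 1/100, so it
    lies outside the support.\<close>
  have vanish: "integral {-1..1} (\<lambda>a. (1 - a\<^sup>2)\<^sup>2 * diff4 (1/100) abs (dy - a * dx)) = 0"
    if far: "\<bar>dy\<bar> \<ge> \<bar>dx\<bar> + 1/50"
  proof -
    have "diff4 (1/100) abs (dy - a * dx) = 0" if "a \<in> {-1..1}" for a
    proof (rule diff4_abs_eq_0)
      have "\<bar>a * dx\<bar> \<le> 1 * \<bar>dx\<bar>"
        unfolding abs_mult using that by (intro mult_right_mono) auto
      then show "2 * (1/100) \<le> \<bar>dy - a * dx\<bar>"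
        using far by linarith
    qed simp
    then have "integral {-1..1} (\<lambda>a. (1 - a\<^sup>2)\<^sup>2 * diff4 (1/100) abs (dy - a * dx)) =
      integral {-1..1} (\<lambda>a::real. 0::real)"
      by (intro integral_cong) simp
    then show ?thesis by simp
  qed
  consider "k = i" | "\<bar>int l - int j\<bar> > \<bar>int k - int i\<bar> + 1"
    | "k \<noteq> i" "\<bar>int l - int j\<bar> \<le> \<bar>int k - int i\<bar> + 1"
    by linarith
  then show ?thesis
  proof cases
    case 1
    then have "\<bar>int l - int j\<bar> \<ge> 1" using ne by auto
    then have "real_of_int \<bar>int l - int j\<bar> \<ge> 1" by linarith
    then have "\<bar>dy\<bar> \<ge> \<bar>dx\<bar> + 1/50"
      using dx dy 1 unfolding m_def by simp
    from vanish[OF this] show ?thesis unfolding dx_def dy_def by simp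
  next
    case 2
    then have "real_of_int \<bar>int l - int j\<bar> \<ge> m + 2" unfolding m_def by linarith
    then have "\<bar>dy\<bar> \<ge> \<bar>dx\<bar> + 1/50"
      using dx dy by linarith
    from vanish[OF this] show ?thesis unfolding dx_def dy_def by simp
  next
    case 3
    have "m \<ge> 1" using 3(1) unfolding m_def by linarith
    \<comment> \<open>The perturbation costs at most 1/4, which is at most \<open>m / 4\<close>;
      cubing this loss yields the factor 64/27 below.\<close>
    then have "\<bar>dx\<bar> \<ge> 3/4 * m" "dx \<noteq> 0" using dx by auto
    then have "(3/4 * m) ^ 3 \<le> \<bar>dx\<bar> ^ 3"
      using \<open>m \<ge> 1\<close> by (intro power_mono) auto
    have "\<bar>integral {-1..1} (\<lambda>a. (1 - a\<^sup>2)\<^sup>2 * diff4 (1/100) abs (dy - a * dx))\<bar>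
        \<le> 2112 * (1/100) ^ 4 / \<bar>dx\<bar> ^ 3"
      by (rule weight_kernel_bound) (use \<open>dx \<noteq> 0\<close> in auto)
    also have "\<dots> \<le> 2112 * (1/100) ^ 4 / (3/4 * m) ^ 3"
      using \<open>(3/4 * m) ^ 3 \<le> \<bar>dx\<bar> ^ 3\<close> \<open>m \<ge> 1\<close> by (intro divide_left_mono) auto
    also have "\<dots> = 2112 * (1/100) ^ 4 * 64 / 27 * (1 / m ^ 3)"
      by (simp add: power_mult_distrib power_divide)
    also have "\<dots> \<le> 1 / 19000 * (1 / m ^ 3)"
      using \<open>m \<ge> 1\<close> by (intro mult_right_mono) (auto simp: power_divide)
    finally show ?thesis
      using 3 unfolding dx_def dy_def m_def by simp
  qed
qed

lemma perturbed_grid_discrepancy: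
  fixes x y c :: "nat \<times> nat \<Rightarrow> real" and N :: nat
  defines "I \<equiv> {..<N} \<times> {..<N}"
  assumes x: "\<And>i j. (i, j) \<in> I \<Longrightarrow> \<bar>x (i, j) - i\<bar> \<le> 1/8"
    and y: "\<And>i j. (i, j) \<in> I \<Longrightarrow> \<bar>y (i, j) - j\<bar> \<le> 1/8"
    and c: "\<And>p. p \<in> I \<Longrightarrow> \<bar>c p\<bar> = 1"
    and D: "\<And>a t. \<bar>\<Sum>p\<in>I. c p * of_bool (y p - a * x p < t)\<bar> \<le> D"
  shows "real N \<le> 3500 * D\<^sup>2"
proof (cases "N = 0")
  case False
  have I: "finite I" "card I = N * N" unfolding I_def by auto
  \<comment> \<open>The diagonal is of order \<open>w\<close> and the off-diagonal row sums of order
    \<open>w ^ 4\<close>. At 1/100 these are 64/1500 against at most 20/19000, leaving more than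
    4/100 in each row, for any signs \<open>c\<close>.\<close>
  define w :: real where "w = 1/100"
  define k where "k p q a = diff4 w abs ((y p - y q) - a * (x p - x q))" for p q a
  define K where "K p q = integral {-1..1} (\<lambda>a. (1 - a\<^sup>2)\<^sup>2 * k p q a)" for p q
  have K: "((\<lambda>a. (1 - a\<^sup>2)\<^sup>2 * k p q a) has_integral K p q) {-1..1}" for p q
    unfolding K_def k_def
    by (intro integrable_integral integrable_continuous_interval continuous_intros)
  have diag: "K p p = - 64 / 1500" for p
  proof -
    have "k p p a = - 4 / 100" for a
      unfolding k_def using diff4_abs_0[of w] by (simp add: w_def)
    then have "((\<lambda>a. (1 - a\<^sup>2)\<^sup>2 * k p p a) has_integral 16 / 15 * (- 4 / 100)) {-1..1}"
      using has_integral_mult_left[OF integral_weight, of "- 4 / 100"] by simp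
    then show ?thesis unfolding K_def by (simp add: integral_unique)
  qed
  have row: "(\<Sum>q\<in>I. c p * c q * K p q) \<le> - 4 / 100" if p: "p \<in> I" for p
  proof -
    obtain i j where ij: "p = (i, j)" by (cases p)
    have "i < N" using p unfolding ij I_def by simp
    let ?b = "\<lambda>(k, l). if k \<noteq> i \<and> \<bar>int l - int j\<bar> \<le> \<bar>int k - int i\<bar> + 1
      then 1 / real_of_int \<bar>int k - int i\<bar> ^ 3 else 0"
    have "(\<Sum>q\<in>I - {p}. c p * c q * K p q) \<le> (\<Sum>q\<in>I - {p}. ?b q / 19000)"
    proof (rule sum_mono)
      fix q
      assume q: "q \<in> I - {p}"
      obtain k' l where kl: "q = (k', l)" by (cases q)
      have "c p * c q * K p q \<le> \<bar>c p\<bar> * \<bar>c q\<bar> * \<bar>K p q\<bar>"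
        unfolding abs_mult[symmetric] by (rule abs_ge_self)
      also have "\<dots> = \<bar>K p q\<bar>" using c p q by simp
      also have "\<dots> \<le> ?b q / 19000"
        using perturbed_grid_kernel_bound[of x i j k' l y] x[of i j] x[of k' l] y[of i j] y[of k' l] p q
        unfolding K_def k_def w_def ij kl by auto
      finally show "c p * c q * K p q \<le> ?b q / 19000" .
    qed
    also have "\<dots> \<le> (\<Sum>q\<in>I. ?b q / 19000)"
      by (rule sum_mono2) (use I in \<open>auto split: prod.split\<close>)
    also have "\<dots> = (\<Sum>q\<in>I. ?b q) / 19000"
      by (simp only: sum_divide_distrib)
    also have "\<dots> \<le> 20 / 19000"
      using cone_sum_le[OF \<open>i < N\<close>, of j] unfolding I_def by simp
    finally have "(\<Sum>q\<in>I - {p}. c p * c q * K p q) \<le> 20 / 19000" .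
    moreover have "c p * c p * K p p = - 64 / 1500"
      using c[OF p] diag by (simp add: abs_if split: if_splits)
    moreover have "(\<Sum>q\<in>I. c p * c q * K p q) = c p * c p * K p p + (\<Sum>q\<in>I - {p}. c p * c q * K p q)"
      using I p by (intro sum.remove) auto
    ultimately show ?thesis by linarith
  qed
  have "((\<lambda>a. \<Sum>p\<in>I. \<Sum>q\<in>I. c p * c q * ((1 - a\<^sup>2)\<^sup>2 * k p q a)) has_integral
      (\<Sum>p\<in>I. \<Sum>q\<in>I. c p * c q * K p q)) {-1..1}"
    by (intro has_integral_sum has_integral_mult_right K I)
  then have lhs: "((\<lambda>a. - (\<Sum>p\<in>I. \<Sum>q\<in>I. c p * c q * ((1 - a\<^sup>2)\<^sup>2 * k p q a))) has_integral
      - (\<Sum>p\<in>I. \<Sum>q\<in>I. c p * c q * K p q)) {-1..1}"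
    by (rule has_integral_neg)
  have rhs: "((\<lambda>a. (1 - a\<^sup>2)\<^sup>2 * (64 * (2 * real N) * D\<^sup>2)) has_integral
      16 / 15 * (64 * (2 * real N) * D\<^sup>2)) {-1..1}"
    by (rule has_integral_mult_left[OF integral_weight])
  have "- (\<Sum>p\<in>I. \<Sum>q\<in>I. c p * c q * ((1 - a\<^sup>2)\<^sup>2 * k p q a))
      \<le> (1 - a\<^sup>2)\<^sup>2 * (64 * (2 * real N) * D\<^sup>2)" if a: "a \<in> {-1..1}" for a
  proof -
    have "- (\<Sum>p\<in>I. \<Sum>q\<in>I. c p * c q * diff4 w abs ((y p - a * x p) - (y q - a * x q)))
      \<le> 64 * (2 * real N) * D\<^sup>2"
    proof (rule energy_bound)
      fix p
      assume p: "p \<in> I"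
      obtain i j where ij: "p = (i, j)" by (cases p)
      have "\<bar>a * x p\<bar> \<le> 1 * \<bar>x p\<bar>"
        unfolding abs_mult using a by (intro mult_right_mono) auto
      moreover have "real i \<le> real N - 1" "real j \<le> real N - 1"
        using p unfolding ij I_def by auto
      \<comment> \<open>With coordinates in [-1/8, N - 7/8] and
        \<open>\<bar>a\<bar> \<le> 1\<close>, all intercepts, even shifted by \<open>w\<close>, lie
        within \<open>2 * real N\<close> of 0.\<close>
      then have "\<bar>x p\<bar> \<le> real N - 7/8" "\<bar>y p\<bar> \<le> real N - 7/8"
        using x[of i j] y[of i j] p unfolding ij by linarith+
      ultimately show "\<bar>y p - a * x p\<bar> + w \<le> 2 * real N"
        using abs_triangle_ineq4[of "y p" "a * x p"] unfolding w_def by linarith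
    qed (use I D in \<open>auto simp: w_def\<close>)
    also have "(\<Sum>p\<in>I. \<Sum>q\<in>I. c p * c q * diff4 w abs ((y p - a * x p) - (y q - a * x q)))
      = (\<Sum>p\<in>I. \<Sum>q\<in>I. c p * c q * k p q a)"
      unfolding k_def by (intro sum.cong refl arg_cong2[where f = "(*)"] arg_cong[where f = "diff4 w abs"])
        (simp add: algebra_simps)
    finally have "(1 - a\<^sup>2)\<^sup>2 * - (\<Sum>p\<in>I. \<Sum>q\<in>I. c p * c q * k p q a)
      \<le> (1 - a\<^sup>2)\<^sup>2 * (64 * (2 * real N) * D\<^sup>2)"
      by (intro mult_left_mono) auto
    then show ?thesis
      by (simp only: mult_minus_right sum_distrib_left mult.left_commute)
  qed
  from has_integral_le[OF lhs rhs this]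
  have "- (\<Sum>p\<in>I. \<Sum>q\<in>I. c p * c q * K p q) \<le> 16 / 15 * (64 * (2 * real N) * D\<^sup>2)"
    by simp
  moreover have "(\<Sum>p\<in>I. \<Sum>q\<in>I. c p * c q * K p q) \<le> (\<Sum>p\<in>I. - 4 / 100)"
    by (intro sum_mono row)
  \<comment> \<open>The \<open>N * N\<close> rows give \<open>N\<^sup>2\<close> on the left, while
    the range of intercepts gives only one factor \<open>N\<close> on the right. After cancelling,
    25 * 128 * 16/15 < 3500.\<close>
  ultimately have "4 / 100 * (real N * real N) \<le> real N * (16 / 15 * 128 * D\<^sup>2)"
    using I by simp
  then have "real N * (4 / 100 * real N) \<le> real N * (16 / 15 * 128 * D\<^sup>2)"
    by (simp add: mult_ac)
  then have "4 / 100 * real N \<le> 16 / 15 * 128 * D\<^sup>2"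
    using False by (simp only: mult_le_cancel_left_pos of_nat_0_less_iff)
  then show ?thesis
    using zero_le_power2[of D] by linarith
qed simp

subsection \<open>Coarseness and general position\<close>

lemma partition_disc_le_coarseness:
  assumes "finite S" "convex_partition S P"
  shows "partition_disc X P \<le> coarseness S X"
  unfolding coarseness_def using assms finite_convex_partitions[OF assms(1)] by (intro Max_ge) auto

lemma disc_le_coarseness:
  assumes "finite S" "S \<noteq> {}"
  shows "disc X S \<le> coarseness S X"
  using partition_disc_le_coarseness[OF assms(1) convex_partition_single[OF assms(2)], of X]
  by (simp add: partition_disc_def)

lemma convex_partition_cut:
  assumes "convex H" "convex (- H)" "S \<inter> H \<noteq> {}" "S - H \<noteq> {}"
  shows "convex_partition S {S \<inter> H, S - H}"
proof -
  have "partition_on S {S \<inter> H, S - H}"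
    using assms by (auto simp: partition_on_def disjoint_def)
  moreover have "island S (S \<inter> H)" "island S (S - H)"
    unfolding island_def using assms by (auto intro: exI[of _ H] exI[of _ "- H"])
  moreover have "convex hull (S \<inter> H) \<subseteq> H" "convex hull (S - H) \<subseteq> - H"
    using assms by (intro hull_minimal; blast)+
  then have "convex hull (S \<inter> H) \<inter> convex hull (S - H) = {}"
    by blast
  ultimately show ?thesis
    unfolding convex_partition_def pairwise_def by (simp add: Int_commute)
qed

text \<open>One of the two sides has discrepancy at most the coarseness. If it is
  \<open>S - H\<close>, then \<open>S \<inter> H\<close> differs from the whole of \<open>S\<close>
  by that much, and \<open>S\<close> itself is bounded through the one-part partition.\<close>

lemma cut_disc_le_coarseness:
  assumes "finite S" "S \<noteq> {}" "convex H" "convex (- H)"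
  shows "disc X (S \<inter> H) \<le> 2 * coarseness S X"
proof -
  have S: "disc X S \<le> coarseness S X"
    by (rule disc_le_coarseness) fact+
  have nn: "0 \<le> disc X Y" for Y
    by (simp add: disc_def)
  \<comment> \<open>Parts must be nonempty, so cuts missing or containing all of \<open>S\<close>
    are handled by the one-part partition.\<close>
  consider "S \<inter> H = {}" | "S \<inter> H = S" | "S \<inter> H \<noteq> {}" "S - H \<noteq> {}"
    by blast
  then show ?thesis
  proof cases
    case 1
    then show ?thesis using S nn[of S] by (simp add: disc_def)
  next
    case 2
    then show ?thesis using S nn[of S] by simp
  next
    case 3
    have "(\<Sum>y\<in>S. X y) = (\<Sum>y\<in>S \<inter> H. X y) + (\<Sum>y\<in>S - H. X y)"
      using assms(1) by (rule sum.Int_Diff)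
    then have "disc X (S \<inter> H) \<le> disc X S + disc X (S - H)"
      unfolding disc_def by linarith
    moreover have "min (disc X (S \<inter> H)) (disc X (S - H)) \<le> coarseness S X"
      using partition_disc_le_coarseness[OF assms(1) convex_partition_cut[OF assms(3,4) 3], of X]
      by (simp add: partition_disc_def)
    ultimately show ?thesis using S nn[of S] by linarith
  qed
qed

section \<open>Perturbation into general position\<close>

text \<open>Finitely many lines have measure zero and cannot cover a ball. The case
  \<open>a = b\<close> is included, so \<open>q\<close> also avoids \<open>S\<close> itself.\<close>

lemma exists_point_off_lines:
  fixes p :: "real^2"
  assumes "finite S" "e > 0"
  obtains q where "dist q p < e" "\<And>a b. a \<in> S \<Longrightarrow> b \<in> S \<Longrightarrow> q \<notin> affine hull {a, b}"
proof -
  let ?B = "\<Union>(a, b)\<in>S \<times> S. affine hull {a, b}"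
  have "negligible (affine hull {a, b})" for a b :: "real^2"
  proof -
    have "interior (affine hull {a, b}) = {}"
      by (rule empty_interior_affine_hull) (auto simp: card_insert_if)
    then show ?thesis
      using negligible_convex_interior affine_imp_convex affine_affine_hull by blast
  qed
  then have "negligible ?B"
    using assms(1) by (intro negligible_Union) auto
  then have "\<not> ball p e \<subseteq> ?B"
    using assms(2) negligible_subset open_not_negligible[of "ball p e"] by auto
  then obtain q where "q \<in> ball p e" "q \<notin> ?B"
    by blast
  then show ?thesis
    by (intro that[of q]) (auto simp: dist_commute)
qed

lemma general_position_insert:
  assumes "general_position S" "\<And>a b. a \<in> S \<Longrightarrow> b \<in> S \<Longrightarrow> q \<notin> affine hull {a, b}"
  shows "general_position (insert q S)"
  unfolding general_position_def
proof (intro allI impI notI)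
  fix T
  assume T: "T \<subseteq> insert q S" "card T = 3" "collinear T"
  show False
  proof (cases "q \<in> T")
    case True
    then have "card (T - {q}) = 2"
      using T(2) by simp
    then obtain a b where ab: "T - {q} = {a, b}" "a \<noteq> b"
      by (auto simp: card_2_iff)
    then have "T = {a, b, q}" "a \<in> S" "b \<in> S"
      using True T(1) by auto
    then show False
      using T(3) ab(2) assms(2) by (simp add: collinear_3_affine_hull)
  next
    case False
    then show False
      using T assms(1) unfolding general_position_def by blast
  qed
qed

text \<open>The points are placed one at a time, each close to its target and off every line through
  two points already placed.\<close>

lemma general_position_perturbation:
  fixes P :: "'a \<Rightarrow> real^2"
  assumes "finite A" "e > 0"
  shows "\<exists>f. (\<forall>a\<in>A. dist (f a) (P a) < e) \<and> inj_on f A \<and> general_position (f ` A)"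
  using assms(1)
proof induction
  case empty
  then show ?case by (simp add: general_position_def)
next
  case (insert z A)
  then obtain f where f: "\<forall>a\<in>A. dist (f a) (P a) < e" "inj_on f A" "general_position (f ` A)"
    by blast
  obtain q where q: "dist q (P z) < e" "\<And>a b. a \<in> f ` A \<Longrightarrow> b \<in> f ` A \<Longrightarrow> q \<notin> affine hull {a, b}"
    using exists_point_off_lines[of "f ` A" e "P z"] insert.hyps assms(2) by blast
  have "q \<notin> f ` A"
    using q(2) by (metis hull_inc insertI1)
  have img: "(f(z := q)) ` A = f ` A"
    using insert.hyps by auto
  have "inj_on (f(z := q)) (insert z A)"
    using f(2) insert.hyps \<open>q \<notin> f ` A\<close> by (auto simp: inj_on_def)
  moreover have "general_position ((f(z := q)) ` insert z A)"
    using general_position_insert[OF f(3) q(2)] by (simp only: image_insert fun_upd_same img)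
  moreover have "\<forall>a\<in>insert z A. dist ((f(z := q)) a) (P a) < e"
    using f(1) q(1) insert.hyps by auto
  ultimately show ?case
    by blast
qed

section \<open>Coarseness of the perturbed grid\<close>

theorem theorem4:
  shows "\<exists>C::real. C > 0 \<and>
    (\<forall>N::nat. \<exists>n\<ge>N. \<exists>S :: (real^2) set.
       finite S \<and> card S = n \<and> general_position S \<and>
       (\<forall>X. coloring S X \<longrightarrow>
          real_of_int (coarseness S X) \<ge> C * real n powr (1/4)))"
proof (intro exI[of _ "1/120"] conjI allI)
  fix M :: nat
  \<comment> \<open>The successor keeps the grid nonempty and ensures
    \<open>N * N \<ge> M\<close>.\<close>
  define N where "N = Suc M"
  define I where "I = {..<N} \<times> {..<N}"
  have I: "finite I" "card I = N * N" "I \<noteq> {}"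
    unfolding I_def N_def by auto
  define P :: "nat \<times> nat \<Rightarrow> real^2" where "P = (\<lambda>(i, j). vector [real i, real j])"
  obtain f where f: "\<And>p. p \<in> I \<Longrightarrow> dist (f p) (P p) < 1/8" "inj_on f I" "general_position (f ` I)"
    using general_position_perturbation[OF I(1), of "1/8" P] by auto
  define S where "S = f ` I"
  have S: "finite S" "card S = N * N" "S \<noteq> {}"
    unfolding S_def using I f(2) by (auto simp: card_image)
  have near: "\<bar>f (i, j) $ 1 - real i\<bar> \<le> 1/8" "\<bar>f (i, j) $ 2 - real j\<bar> \<le> 1/8" if "(i, j) \<in> I" for i j
    using f(1)[OF that] component_le_norm_cart[of "f (i, j) - P (i, j)" 1]
      component_le_norm_cart[of "f (i, j) - P (i, j)" 2]
    by (auto simp: dist_norm P_def)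
  have "1/120 * real (N * N) powr (1/4) \<le> real_of_int (coarseness S X)" if X: "coloring S X" for X
  proof -
    define c where "c = real_of_int (coarseness S X)"
    have "c \<ge> 0"
      using disc_le_coarseness[OF S(1,3), of X] unfolding c_def by (simp add: disc_def)
    have "real N \<le> 3500 * (2 * c)\<^sup>2"
    proof (rule perturbed_grid_discrepancy)
      fix p
      assume "p \<in> {..<N} \<times> {..<N}"
      then have "f p \<in> S" unfolding S_def I_def by blast
      then have "X (f p) \<in> {-1, 1}"
        using X unfolding coloring_def by (rule funcset_mem[rotated])
      then show "\<bar>real_of_int (X (f p))\<bar> = 1"
        by auto
    next
      fix a t :: real
      \<comment> \<open>The open half-plane below the line of slope \<open>a\<close> and intercept
        \<open>t\<close>; its complement is a closed half-plane, so both are convex.\<close>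
      define H where "H = {s :: real^2. vector [- a, 1] \<bullet> s < t}"
      have "convex H" "convex (- H)"
        unfolding H_def Compl_eq by (auto simp: not_less intro: convex_halfspace_lt convex_halfspace_ge)
      then have "disc X (S \<inter> H) \<le> 2 * coarseness S X"
        by (intro cut_disc_le_coarseness S)
      moreover have "(\<Sum>p\<in>I. real_of_int (X (f p)) * of_bool (f p $ 2 - a * f p $ 1 < t))
          = real_of_int (\<Sum>s\<in>S \<inter> H. X s)"
      proof -
        have "(\<Sum>p\<in>I. real_of_int (X (f p)) * of_bool (f p $ 2 - a * f p $ 1 < t))
            = (\<Sum>s\<in>S. real_of_int (X s) * of_bool (s \<in> H))"
          unfolding S_def sum.reindex[OF f(2)] by (simp add: H_def inner_vec_def sum_2)
        also have "\<dots> = (\<Sum>s\<in>S \<inter> H. real_of_int (X s))"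
          using S(1) by (intro sum.mono_neutral_cong_right) auto
        finally show ?thesis by simp
      qed
      ultimately show "\<bar>\<Sum>p\<in>{..<N} \<times> {..<N}. real_of_int (X (f p)) * of_bool (f p $ 2 - a * f p $ 1 < t)\<bar>
          \<le> 2 * c"
        unfolding I_def[symmetric] c_def disc_def by linarith
    qed (use near in \<open>auto simp: I_def\<close>)
    \<comment> \<open>The factor 1/120 works because 3500 * 4 = 14000 is at most 120
      squared.\<close>
    then have "(1/120 * sqrt (real N))\<^sup>2 \<le> c\<^sup>2"
      by (simp add: power_mult_distrib power_divide)
    then have "1/120 * sqrt (real N) \<le> c"
      using \<open>c \<ge> 0\<close> by (rule power2_le_imp_le)
    moreover have "real (N * N) powr (1/4) = sqrt (real N)"
      by (simp add: powr_mult powr_add[symmetric] powr_half_sqrt[symmetric])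
    ultimately show ?thesis unfolding c_def by simp
  qed
  moreover have "N * N \<ge> M"
    unfolding N_def by simp
  ultimately show "\<exists>n\<ge>M. \<exists>S :: (real^2) set.
       finite S \<and> card S = n \<and> general_position S \<and>
       (\<forall>X. coloring S X \<longrightarrow>
          real_of_int (coarseness S X) \<ge> 1/120 * real n powr (1/4))"
    using S f(3) unfolding S_def by blast
qed simp

end
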